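(* Let $\Gamma$ be a metrized graph with $\ell(\Gamma)=1$, with edges $e_1,\dots,e_e$ of lengths $L_i$, and let $R_i$ be as defined in the context. Then $$\tau(\Gamma)\ge \frac1{12}\,\frac{1}{\big(1+\sum_{i}R_i\big)^2}.$$ In particular, if any pair of vertices $p_i,q_i$ that are end points of an edge are joined by at least two edges, then $\tau(\Gamma)\ge\frac1{48}$.
   Context: A metrized graph is a finite connected graph (multiple edges and self-loops allowed) in which each edge $e_i$ is identified with a closed interval of positive length $L_i$; $\ell(\Gamma)=\sum_i L_i$. Regard $\Gamma$ as a resistive circuit with each segment's resistance equal to its length; $r(x,y)$ is the effective resistance. For an edge $e_i$ with end points $p_i,q_i$, $\Gamma-e_i$ denotes $\Gamma$ with the interior of $e_i$ deleted, and $R_i$ is the effective resistance between $p_i$ and $q_i$ in $\Gamma-e_i$ ($R_i=\infty$ if $\Gamma-e_i$ is disconnected). The tau constant is $\tau(\Gamma)=\frac14\int_\Gamma\big(\frac{\partial}{\partial x}r(x,y)\big)^2dx$ (independent of $y$). *)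

theory Defs
  imports "HOL-Analysis.Analysis" "Graph_Theory.Digraph_Component"
begin

text \<open>
  A metrized graph is a finite connected multigraph \<open>G\<close> with positive edge lengths \<open>L\<close>.
  The orientation of the arcs only serves to parametrize the edge \<open>e\<close> by \<open>{0..L e}\<close>, from
  \<open>tail G e\<close> to \<open>head G e\<close>.  The graph-theoretic \<open>connected\<close> is the weak one, i.e.
  it ignores the orientation (and it excludes the empty graph); parallel arcs and loops are allowed
  by \<open>fin_digraph\<close>.
\<close>

locale metrized_graph = fin_digraph G for G :: "('a, 'b) pre_digraph" +
  fixes L :: "'b \<Rightarrow> real"
  assumes connected: "Digraph_Component.connected G"
    and length_pos: "\<And>e. e \<in> arcs G \<Longrightarrow> 0 < L e"

definition total_length :: "('a, 'b) pre_digraph \<Rightarrow> ('b \<Rightarrow> real) \<Rightarrow> real" where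
  "total_length G L = (\<Sum>e\<in>arcs G. L e)"


text \<open>
  In a resistor network with resistances \<open>L\<close>, the potential \<open>f\<close> drives by Ohm's law the current
  \<open>(f (tail G e) - f (head G e)) / L e\<close> along \<open>e\<close>.  A unit potential is one for which a unit
  current enters at \<open>p\<close> and leaves at \<open>q\<close>, and Kirchhoff's current law holds at all other nodes.
\<close>

definition net_outflow :: "('a, 'b) pre_digraph \<Rightarrow> ('b \<Rightarrow> real) \<Rightarrow> ('a \<Rightarrow> real) \<Rightarrow> 'a \<Rightarrow> real" where
  "net_outflow G L f v =
     (\<Sum>e | e \<in> arcs G \<and> tail G e = v. (f (tail G e) - f (head G e)) / L e)
   - (\<Sum>e | e \<in> arcs G \<and> head G e = v. (f (tail G e) - f (head G e)) / L e)"

definition unit_potential ::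
    "('a, 'b) pre_digraph \<Rightarrow> ('b \<Rightarrow> real) \<Rightarrow> 'a \<Rightarrow> 'a \<Rightarrow> ('a \<Rightarrow> real) \<Rightarrow> bool" where
  "unit_potential G L p q f \<longleftrightarrow>
     (\<forall>v\<in>verts G. net_outflow G L f v = of_bool (v = p) - of_bool (v = q))"

definition eff_resistance :: "('a, 'b) pre_digraph \<Rightarrow> ('b \<Rightarrow> real) \<Rightarrow> 'a \<Rightarrow> 'a \<Rightarrow> real" where
  "eff_resistance G L p q = (THE r. \<exists>f. unit_potential G L p q f \<and> r = f p - f q)"


datatype ('a, 'b) point = Vertex 'a | Inner 'b real

definition points :: "('a, 'b) pre_digraph \<Rightarrow> ('b \<Rightarrow> real) \<Rightarrow> ('a, 'b) point set" where
  "points G L = Vertex ` verts G \<union> {Inner e t | e t. e \<in> arcs G \<and> 0 < t \<and> t < L e}"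

definition edge_point :: "('a, 'b) pre_digraph \<Rightarrow> ('b \<Rightarrow> real) \<Rightarrow> 'b \<Rightarrow> real \<Rightarrow> ('a, 'b) point" where
  "edge_point G L e t =
     (if t = 0 then Vertex (tail G e) else if t = L e then Vertex (head G e) else Inner e t)"

text \<open>
  The subdivision of the metrized graph that makes the points of a finite set \<open>S\<close> vertices.
  The arc \<open>(e, a, b)\<close> is the segment \<open>{a..b}\<close> of \<open>e\<close> between two consecutive cut points.
\<close>

definition cuts :: "('b \<Rightarrow> real) \<Rightarrow> ('a, 'b) point set \<Rightarrow> 'b \<Rightarrow> real set" where
  "cuts L S e = {0, L e} \<union> {t. 0 < t \<and> t < L e \<and> Inner e t \<in> S}"

definition subdivide :: "('a, 'b) pre_digraph \<Rightarrow> ('b \<Rightarrow> real) \<Rightarrow> ('a, 'b) point set \<Rightarrow>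
    (('a, 'b) point, 'b \<times> real \<times> real) pre_digraph" where
  "subdivide G L S =
     \<lparr> verts = Vertex ` verts G \<union> S,
       arcs = {(e, a, b). e \<in> arcs G \<and> a \<in> cuts L S e \<and> b \<in> cuts L S e \<and> a < b
                 \<and> {a<..<b} \<inter> cuts L S e = {}},
       tail = (\<lambda>(e, a, b). edge_point G L e a),
       head = (\<lambda>(e, a, b). edge_point G L e b) \<rparr>"

definition segment_length :: "'b \<times> real \<times> real \<Rightarrow> real" where
  "segment_length = (\<lambda>(e, a, b). b - a)"

definition resistance ::
    "('a, 'b) pre_digraph \<Rightarrow> ('b \<Rightarrow> real) \<Rightarrow> ('a, 'b) point \<Rightarrow> ('a, 'b) point \<Rightarrow> real" where
  "resistance G L x y = eff_resistance (subdivide G L {x, y}) segment_length x y"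


definition edge_resistance :: "('a, 'b) pre_digraph \<Rightarrow> ('b \<Rightarrow> real) \<Rightarrow> 'b \<Rightarrow> ereal" where
  "edge_resistance G L e =
     (if Digraph_Component.connected (pre_digraph.del_arc G e)
      then ereal (eff_resistance (pre_digraph.del_arc G e) L (tail G e) (head G e))
      else \<infinity>)"

text \<open>
  The tau constant, computed with the base point \<open>y\<close>.  On each edge the derivative exists except
  possibly at \<open>y\<close> and at the two end points.
\<close>

definition tau :: "('a, 'b) pre_digraph \<Rightarrow> ('b \<Rightarrow> real) \<Rightarrow> ('a, 'b) point \<Rightarrow> real" where
  "tau G L y = 1 / 4 *
     (\<Sum>e\<in>arcs G. integral {0..L e}
        (\<lambda>t. (deriv (\<lambda>s. resistance G L (edge_point G L e s) y) t)\<^sup>2))"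

definition edges_between :: "('a, 'b) pre_digraph \<Rightarrow> 'a \<Rightarrow> 'a \<Rightarrow> 'b set" where
  "edges_between G p q = {e \<in> arcs G. {tail G e, head G e} = {p, q}}"

end

theory Submission
  imports Defs
begin

text \<open>
  Let \<open>\<rho>\<close> be the resistance in the whole graph between the ends of the edge \<open>e\<close>.  Along \<open>e\<close> the
  function \<open>r(x, y)\<close> is quadratic with leading coefficient \<open>(\<rho> - L) / L\<^sup>2 = - 1 / (L + R)\<close>, apart from
  the kink \<open>\<bar>x - y\<bar>\<close> if \<open>y\<close> lies on \<open>e\<close>; hence \<open>e\<close> contributes at least \<open>L\<^sup>3 / (3 (L + R)\<^sup>2)\<close> to the
  integral, and the first bound is Jensen's inequality for \<open>1 / x\<^sup>2\<close>.  If adjacent vertices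
  are joined by several edges, then \<open>R\<close> of one edge is at most the length of any parallel one, so
  the sum of the \<open>R\<close> is at most the total length \<open>1\<close>.
\<close>

section \<open>Potentials and the Dirichlet form\<close>

text \<open>The energy form of the network; for \<open>f = g\<close> it is the power dissipated by
  the potential \<open>f\<close>.\<close>

definition dirichlet ::
    "('a, 'b) pre_digraph \<Rightarrow> ('b \<Rightarrow> real) \<Rightarrow> ('a \<Rightarrow> real) \<Rightarrow> ('a \<Rightarrow> real) \<Rightarrow> real" where
  "dirichlet G L f g =
     (\<Sum>e\<in>arcs G. (f (tail G e) - f (head G e)) * (g (tail G e) - g (head G e)) / L e)"

lemma dirichlet_commute: "dirichlet G L f g = dirichlet G L g f"
  by (simp add: dirichlet_def mult.commute)

lemma dirichlet_add_left:
  "dirichlet G L (\<lambda>v. f v + f' v) g = dirichlet G L f g + dirichlet G L f' g"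
  unfolding dirichlet_def sum.distrib[symmetric] divide_inverse
  by (intro sum.cong) (auto simp: algebra_simps)

lemma dirichlet_scale_left: "dirichlet G L (\<lambda>v. c * f v) g = c * dirichlet G L f g"
  unfolding dirichlet_def sum_distrib_left divide_inverse
  by (intro sum.cong) (auto simp: algebra_simps)

lemma dirichlet_diff_left:
  "dirichlet G L (\<lambda>v. f v - f' v) g = dirichlet G L f g - dirichlet G L f' g"
  unfolding dirichlet_def sum_subtractf[symmetric] divide_inverse
  by (intro sum.cong) (auto simp: algebra_simps)

text \<open>Summation by parts: the current of each arc is counted once at its tail and once, with
  the opposite sign, at its head.\<close>

lemma (in fin_digraph) sum_net_outflow:
  "(\<Sum>v\<in>verts G. g v * net_outflow G L f v) = dirichlet G L f g"
proof -
  let ?c = "\<lambda>e. (f (tail G e) - f (head G e)) / L e"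
  have t: "(\<Sum>v\<in>verts G. \<Sum>e\<in>{e \<in> arcs G. tail G e = v}. g (tail G e) * ?c e)
      = (\<Sum>e\<in>arcs G. g (tail G e) * ?c e)"
    by (rule sum.group) auto
  have h: "(\<Sum>v\<in>verts G. \<Sum>e\<in>{e \<in> arcs G. head G e = v}. g (head G e) * ?c e)
      = (\<Sum>e\<in>arcs G. g (head G e) * ?c e)"
    by (rule sum.group) auto
  have "g v * net_outflow G L f v =
      (\<Sum>e\<in>{e \<in> arcs G. tail G e = v}. g (tail G e) * ?c e)
    - (\<Sum>e\<in>{e \<in> arcs G. head G e = v}. g (head G e) * ?c e)" for v
    unfolding net_outflow_def right_diff_distrib sum_distrib_left
    by (intro arg_cong2[where f = "(-)"] sum.cong) auto
  then have "(\<Sum>v\<in>verts G. g v * net_outflow G L f v) =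
      (\<Sum>e\<in>arcs G. g (tail G e) * ?c e) - (\<Sum>e\<in>arcs G. g (head G e) * ?c e)"
    by (simp only: sum_subtractf t h)
  also have "\<dots> = dirichlet G L f g"
    unfolding dirichlet_def sum_subtractf[symmetric] divide_inverse
    by (intro sum.cong) (auto simp: algebra_simps)
  finally show ?thesis .
qed

text \<open>Weak form of Kirchhoff's law: multiply the law by a test function \<open>g\<close> and
  sum over the nodes; testing with indicators of single nodes recovers it. The weak form is linear
  in \<open>f\<close>, so superposition becomes immediate.\<close>

lemma (in fin_digraph) unit_potential_iff_dirichlet:
  assumes "p \<in> verts G" "q \<in> verts G"
  shows "unit_potential G L p q f \<longleftrightarrow> (\<forall>g. dirichlet G L f g = g p - g q)"
proof
  assume u: "unit_potential G L p q f"
  show "\<forall>g. dirichlet G L f g = g p - g q"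
  proof
    fix g :: "'a \<Rightarrow> real"
    have "dirichlet G L f g = (\<Sum>v\<in>verts G. (if v = p then g v else 0) - (if v = q then g v else 0))"
      unfolding sum_net_outflow[symmetric]
      using u by (intro sum.cong) (auto simp: unit_potential_def)
    also have "\<dots> = g p - g q"
      using assms by (simp add: sum_subtractf)
    finally show "dirichlet G L f g = g p - g q" .
  qed
next
  assume d: "\<forall>g. dirichlet G L f g = g p - g q"
  show "unit_potential G L p q f"
    unfolding unit_potential_def
  proof
    fix v assume v: "v \<in> verts G"
    have "net_outflow G L f v = (\<Sum>w\<in>verts G. of_bool (w = v) * net_outflow G L f w)"
      using v by (simp add: of_bool_def if_distrib[where f = "\<lambda>x. x * _"] cong: if_cong)
    also have "\<dots> = of_bool (p = v) - of_bool (q = v)"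
      using d by (simp only: sum_net_outflow)
    finally show "net_outflow G L f v = of_bool (v = p) - of_bool (v = q)"
      by (simp add: eq_commute)
  qed
qed

text \<open>Uniqueness of the resistance is reciprocity (symmetry of the Dirichlet form), so it needs no
  connectedness.\<close>

lemma (in fin_digraph) eff_resistance_eq:
  assumes "p \<in> verts G" "q \<in> verts G" "unit_potential G L p q f"
  shows "eff_resistance G L p q = f p - f q"
  unfolding eff_resistance_def
proof (rule the_equality)
  show "\<exists>g. unit_potential G L p q g \<and> f p - f q = g p - g q"
    using assms by blast
next
  fix r assume "\<exists>g. unit_potential G L p q g \<and> r = g p - g q"
  then obtain g where "unit_potential G L p q g" "r = g p - g q" by blast
  then show "r = f p - f q"
    using assms by (metis dirichlet_commute unit_potential_iff_dirichlet)
qed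

section \<open>Energy bounds and the parallel law\<close>

lemma dirichlet_self_nonneg:
  assumes "\<And>e. e \<in> arcs G \<Longrightarrow> 0 < L e"
  shows "0 \<le> dirichlet G L f f"
  unfolding dirichlet_def using assms by (intro sum_nonneg) (simp add: less_imp_le)

text \<open>Testing \<open>f\<close> against itself shows that the drop is the energy of
  \<open>f\<close>.\<close>

lemma (in fin_digraph) unit_potential_drop_nonneg:
  assumes "\<And>e. e \<in> arcs G \<Longrightarrow> 0 < L e" "p \<in> verts G" "q \<in> verts G" "unit_potential G L p q f"
  shows "0 \<le> f p - f q"
  using dirichlet_self_nonneg[of G L f] assms by (metis unit_potential_iff_dirichlet)

text \<open>Let \<open>r\<close> be the drop. It equals the total energy, of which \<open>e\<close>
  alone accounts for \<open>r * r / L e\<close>; hence \<open>r * r / L e \<le> r\<close>.\<close>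

lemma (in fin_digraph) unit_potential_drop_le_length:
  assumes pos: "\<And>e. e \<in> arcs G \<Longrightarrow> 0 < L e" and "p \<in> verts G" "q \<in> verts G"
    and f: "unit_potential G L p q f"
    and e: "e \<in> arcs G" "{tail G e, head G e} = {p, q}"
  shows "f p - f q \<le> L e"
proof (cases "f p - f q = 0")
  case True
  then show ?thesis using pos[OF e(1)] by simp
next
  case False
  have r: "0 < f p - f q"
    using unit_potential_drop_nonneg[of L p q f] assms False by fastforce
  have "(f (tail G e) - f (head G e)) * (f (tail G e) - f (head G e)) / L e \<le> dirichlet G L f f"
    unfolding dirichlet_def
    by (rule member_le_sum) (use e pos in \<open>auto simp: less_imp_le\<close>)
  moreover have "dirichlet G L f f = f p - f q"
    using assms by (metis unit_potential_iff_dirichlet)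
  moreover have "(f (tail G e) - f (head G e)) * (f (tail G e) - f (head G e)) = (f p - f q) * (f p - f q)"
    using e(2) by (auto simp: doubleton_eq_iff algebra_simps)
  ultimately have "(f p - f q) * (f p - f q) / L e \<le> f p - f q" by simp
  then have "(f p - f q) * (f p - f q) \<le> (f p - f q) * L e"
    using pos[OF e(1)] by (simp only: pos_divide_le_eq)
  then show ?thesis using r by (simp only: mult_le_cancel_left_pos)
qed

lemma (in fin_digraph) dirichlet_del_arc:
  assumes "e \<in> arcs G"
  shows "dirichlet G L f g = dirichlet (del_arc e) L f g
    + (f (tail G e) - f (head G e)) * (g (tail G e) - g (head G e)) / L e"
  unfolding dirichlet_def by (subst sum.remove[OF _ assms]) auto

text \<open>Put back into \<open>G\<close>, the potential \<open>f\<close> still drives unit current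
  through the other arcs and drives \<open>R / L e\<close> along \<open>e\<close>. The total current
  is \<open>(L e + R) / L e\<close>, and dividing by it normalizes \<open>f\<close>.\<close>

lemma (in fin_digraph) unit_potential_of_del_arc:
  assumes e: "e \<in> arcs G" and "0 < L e"
    and f: "unit_potential (del_arc e) L (tail G e) (head G e) f"
    and R: "R = f (tail G e) - f (head G e)" "0 \<le> R"
  shows "unit_potential G L (tail G e) (head G e) (\<lambda>v. L e / (L e + R) * f v)"
proof -
  interpret D: fin_digraph "del_arc e" by (rule fin_digraph_del_arc)
  have "dirichlet G L f g = (L e + R) / L e * (g (tail G e) - g (head G e))" for g
  proof -
    have d: "dirichlet (del_arc e) L f g = g (tail G e) - g (head G e)"
      using e f D.unit_potential_iff_dirichlet[of "tail G e" "head G e" L f] by simp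
    show ?thesis
      unfolding dirichlet_del_arc[OF e] d R(1)[symmetric]
      using \<open>0 < L e\<close> by (simp add: field_simps)
  qed
  then show ?thesis
    using e \<open>0 < L e\<close> R(2)
    by (simp only: unit_potential_iff_dirichlet dirichlet_scale_left wellformed) simp
qed

section \<open>Existence of unit potentials\<close>

lemma (in fin_digraph) unit_potential_refl: "p \<in> verts G \<Longrightarrow> \<exists>f. unit_potential G L p p f"
  by (rule exI[of _ "\<lambda>_. 0"]) (simp add: unit_potential_iff_dirichlet dirichlet_def)

lemma (in fin_digraph) unit_potential_sym:
  assumes "p \<in> verts G" "q \<in> verts G" "\<exists>f. unit_potential G L p q f"
  shows "\<exists>f. unit_potential G L q p f"
proof -
  obtain f where "unit_potential G L p q f" using assms by blast
  then have "unit_potential G L q p (\<lambda>v. (-1) * f v)"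
    using assms by (simp only: unit_potential_iff_dirichlet dirichlet_scale_left) simp
  then show ?thesis by blast
qed

lemma (in fin_digraph) unit_potential_trans:
  assumes "p \<in> verts G" "q \<in> verts G" "r \<in> verts G"
    and "\<exists>f. unit_potential G L p q f" "\<exists>f. unit_potential G L q r f"
  shows "\<exists>f. unit_potential G L p r f"
proof -
  obtain f g where "unit_potential G L p q f" "unit_potential G L q r g" using assms by blast
  then have "unit_potential G L p r (\<lambda>v. f v + g v)"
    using assms by (simp add: unit_potential_iff_dirichlet dirichlet_add_left)
  then show ?thesis by blast
qed

text \<open>Delete the arc \<open>e\<close>.  If its ends are still joined by a unit potential, rescale that one;
  otherwise \<open>L e\<close> times the indicator of the nodes joined to \<open>tail G e\<close> changes along \<open>e\<close> only.\<close>

lemma unit_potential_arc_exists: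
  assumes "fin_digraph G" "\<And>e. e \<in> arcs G \<Longrightarrow> 0 < L e" "e \<in> arcs G"
  shows "\<exists>f. unit_potential G L (tail G e) (head G e) f"
  using assms
proof (induction "card (arcs G)" arbitrary: G e rule: less_induct)
  case less
  interpret fin_digraph G by fact
  interpret D: fin_digraph "del_arc e" by (rule fin_digraph_del_arc)
  let ?p = "tail G e" and ?q = "head G e"
  have pq: "?p \<in> verts G" "?q \<in> verts G" using less.prems by auto
  have IH: "\<exists>f. unit_potential (del_arc e) L (tail G a) (head G a) f" if "a \<in> arcs (del_arc e)" for a
    using less.hyps[of "del_arc e" a] less.prems that D.fin_digraph_axioms
    by (auto simp: card_Diff1_less simp del: card_Diff_insert)
  show ?case
  proof (cases "\<exists>f. unit_potential (del_arc e) L ?p ?q f")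
    case True
    then obtain f where f: "unit_potential (del_arc e) L ?p ?q f" by blast
    have "0 \<le> f ?p - f ?q"
      using D.unit_potential_drop_nonneg[OF _ _ _ f] less.prems pq by simp
    then show ?thesis
      using unit_potential_of_del_arc[OF _ _ f refl] less.prems by blast
  next
    case False
    define C where "C = {v. \<exists>f. unit_potential (del_arc e) L ?p v f}"
    define f where "f v = (if v \<in> C then L e else 0)" for v
    \<comment> \<open>By \<open>IH\<close> the ends of every remaining arc are joined by a unit
      potential. Being so joined is symmetric and transitive, so no remaining arc leaves
      \<open>C\<close>.\<close>
    have C: "tail G a \<in> C \<longleftrightarrow> head G a \<in> C" if "a \<in> arcs (del_arc e)" for a
    proof -
      have "tail G a \<in> verts (del_arc e)" "head G a \<in> verts (del_arc e)" "?p \<in> verts (del_arc e)"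
        using that pq by auto
      then show ?thesis
        unfolding C_def mem_Collect_eq
        using IH[OF that] D.unit_potential_sym D.unit_potential_trans by blast
    qed
    have "?p \<in> C" unfolding C_def using D.unit_potential_refl pq by simp
    moreover have "?q \<notin> C" unfolding C_def using False by simp
    moreover have "dirichlet (del_arc e) L f g = 0" for g
      unfolding dirichlet_def using C by (intro sum.neutral) (auto simp: f_def)
    ultimately have "unit_potential G L ?p ?q f"
      using pq less.prems(2)[OF less.prems(3)] less.prems(3)
      by (simp add: unit_potential_iff_dirichlet dirichlet_del_arc f_def)
    then show ?thesis by blast
  qed
qed

text \<open>The equivalence carries \<open>P\<close> along an arc in both directions, which matches
  reachability in the symmetric closure.\<close>

lemma connected_induct:
  assumes "Digraph_Component.connected G" "u \<in> verts G" "v \<in> verts G" "P u"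
    and "\<And>e. e \<in> arcs G \<Longrightarrow> P (tail G e) \<longleftrightarrow> P (head G e)"
  shows "P v"
proof -
  have "u \<rightarrow>\<^sup>*\<^bsub>with_proj (mk_symmetric G)\<^esub> v"
    using assms by (auto simp: connected_def strongly_connected_def)
  then show ?thesis
    unfolding reachable_def
  proof (induction rule: rtrancl_on_induct)
    case base
    then show ?case using assms by simp
  next
    case (step y z)
    then show ?case using assms(5) by (auto simp: parcs_mk_symmetric)
  qed
qed

text \<open>Superposition chains the unit potentials of single arcs along an undirected path from
  \<open>p\<close> to \<open>q\<close>.\<close>

lemma (in metrized_graph) unit_potential_exists:
  assumes "p \<in> verts G" "q \<in> verts G"
  shows "\<exists>f. unit_potential G L p q f"
proof (rule connected_induct[OF connected assms(1) assms(2)])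
  show "\<exists>f. unit_potential G L p p f" using unit_potential_refl assms by blast
next
  fix e assume e: "e \<in> arcs G"
  then have "tail G e \<in> verts G" "head G e \<in> verts G" by auto
  moreover have "\<exists>f. unit_potential G L (tail G e) (head G e) f"
    using fin_digraph_axioms length_pos e by (rule unit_potential_arc_exists)
  ultimately show
    "(\<exists>f. unit_potential G L p (tail G e) f) \<longleftrightarrow> (\<exists>f. unit_potential G L p (head G e) f)"
    using unit_potential_trans[OF assms(1)] unit_potential_sym[of "tail G e" "head G e"] by metis
qed

section \<open>Deleting an arc\<close>

lemma connected_del_arc:
  assumes "Digraph_Component.connected G"
    and "tail G e = head G e \<or>
      (\<exists>a\<in>arcs G - {e}. {tail G a, head G a} = {tail G e, head G e})"
  shows "Digraph_Component.connected (pre_digraph.del_arc G e)"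
proof -
  interpret pre_digraph G .
  have "(u, v) \<in> rtrancl_on (verts G) (parcs (mk_symmetric (del_arc e)))"
    if "(u, v) \<in> rtrancl_on (verts G) (parcs (mk_symmetric G))" for u v
    using that
  proof (induction rule: rtrancl_on_induct)
    case base
    then show ?case by simp
  next
    case (step y z)
    have "y = z \<or> (y, z) \<in> parcs (mk_symmetric (del_arc e))"
    proof -
      obtain a where a: "a \<in> arcs G" "(y, z) \<in> {(tail G a, head G a), (head G a, tail G a)}"
        using step by (auto simp: parcs_mk_symmetric)
      show ?thesis
      proof (cases "a = e")
        case False
        then show ?thesis using a by (auto simp: parcs_mk_symmetric)
      next
        case True
        show ?thesis
          using assms(2)
        proof
          assume "tail G e = head G e"
          then show ?thesis using a True by auto
        next
          assume "\<exists>a\<in>arcs G - {e}. {tail G a, head G a} = {tail G e, head G e}"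
          then obtain b where b: "b \<in> arcs G - {e}" "{tail G b, head G b} = {tail G e, head G e}"
            by blast
          then have "(y, z) \<in> {(tail G b, head G b), (head G b, tail G b)}"
            using a True by (auto simp: doubleton_eq_iff)
          then show ?thesis using b by (auto simp: parcs_mk_symmetric)
        qed
      qed
    qed
    then show ?case using step by (auto intro: rtrancl_on_into_rtrancl_on)
  qed
  then show ?thesis
    using assms(1) by (auto simp: connected_def strongly_connected_def reachable_def)
qed

lemma (in metrized_graph) metrized_graph_del_arc:
  assumes "Digraph_Component.connected (del_arc e)"
  shows "metrized_graph (del_arc e) L"
proof -
  interpret D: fin_digraph "del_arc e" by (rule fin_digraph_del_arc)
  show ?thesis by unfold_locales (use assms length_pos in auto)
qed


section \<open>Potentials on a subdivision\<close>

definition consecutive :: "'a::linorder set \<Rightarrow> ('a \<times> 'a) set" where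
  "consecutive C = {(a, b). a \<in> C \<and> b \<in> C \<and> a < b \<and> {a<..<b} \<inter> C = {}}"

lemma consecutive_subset: "consecutive C \<subseteq> C \<times> C"
  by (auto simp: consecutive_def)

text \<open>Induction that adds a new maximum \<open>b\<close>: the only new pair is
  \<open>(Max A, b)\<close>, so the sum telescopes.\<close>

lemma sum_consecutive:
  fixes h :: "'a::linorder \<Rightarrow> 'b::ab_group_add"
  assumes "finite C" "C \<noteq> {}"
  shows "(\<Sum>(a, b)\<in>consecutive C. h b - h a) = h (Max C) - h (Min C)"
  using assms
proof (induction C rule: finite_linorder_max_induct)
  case empty
  then show ?case by simp
next
  case (insert b A)
  show ?case
  proof (cases "A = {}")
    case True
    then have "consecutive (insert b A) = {}" by (auto simp: consecutive_def)
    then show ?thesis using True by simp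
  next
    case False
    have m: "Max A \<in> A" "Max A < b" using insert False by auto
    have "consecutive (insert b A) = insert (Max A, b) (consecutive A)"
    proof (intro set_eqI iffI)
      fix z assume "z \<in> consecutive (insert b A)"
      then obtain c d where z: "z = (c, d)" "c \<in> insert b A" "d \<in> insert b A" "c < d"
        and cd: "{c<..<d} \<inter> insert b A = {}"
        by (auto simp: consecutive_def)
      have c: "c \<in> A" using z insert.hyps by fastforce
      show "z \<in> insert (Max A, b) (consecutive A)"
      proof (cases "d = b")
        case True
        have "c \<le> Max A" using c insert.hyps by simp
        moreover have "\<not> c < Max A"
          using cd True m by (metis IntI empty_iff greaterThanLessThan_iff insertCI)
        ultimately have "c = Max A" by simp
        then show ?thesis using z True by simp
      next
        case False
        then show ?thesis using z c cd by (auto simp: consecutive_def)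
      qed
    next
      fix z assume z: "z \<in> insert (Max A, b) (consecutive A)"
      have "(Max A, b) \<in> consecutive (insert b A)"
        using m insert.hyps by (auto simp: consecutive_def dest: leD[OF Max_ge])
      moreover have "consecutive A \<subseteq> consecutive (insert b A)"
        using insert.hyps by (fastforce simp: consecutive_def)
      ultimately show "z \<in> consecutive (insert b A)" using z by blast
    qed
    moreover have "(Max A, b) \<notin> consecutive A"
      using insert.hyps by (auto simp: consecutive_def)
    moreover have "finite (consecutive A)"
      using insert.hyps finite_subset[OF consecutive_subset] by blast
    moreover have "Max (insert b A) = b"
      using insert.hyps by (intro Max_eqI) (auto simp: less_imp_le)
    moreover have "Min (insert b A) = Min A"
      using insert.hyps False m by (simp add: min_absorb2 less_imp_le)
    ultimately show ?thesis using insert.IH[OF False] by simp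
  qed
qed

text \<open>An affine function has the same slope \<open>k\<close> on all segments, so each term is
  \<open>k * (g b - g a)\<close> and the sum telescopes.\<close>

lemma sum_consecutive_affine:
  fixes C :: "real set"
  assumes "finite C" "C \<noteq> {}"
  shows "(\<Sum>(a, b)\<in>consecutive C. ((c + k * a) - (c + k * b)) * (g a - g b) / (b - a))
    = k * (g (Max C) - g (Min C))"
proof -
  have "(\<Sum>(a, b)\<in>consecutive C. ((c + k * a) - (c + k * b)) * (g a - g b) / (b - a))
      = (\<Sum>(a, b)\<in>consecutive C. k * g b - k * g a)"
  proof (intro sum.cong refl, clarify)
    fix a b assume "(a, b) \<in> consecutive C"
    then have "b - a \<noteq> 0" by (simp add: consecutive_def)
    moreover have "((c + k * a) - (c + k * b)) * (g a - g b) = (k * g b - k * g a) * (b - a)"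
      by (simp add: algebra_simps)
    ultimately show "((c + k * a) - (c + k * b)) * (g a - g b) / (b - a) = k * g b - k * g a"
      by simp
  qed
  also have "\<dots> = k * (g (Max C) - g (Min C))"
    using sum_consecutive[OF assms, of "\<lambda>t. k * g t"] by (simp add: right_diff_distrib)
  finally show ?thesis .
qed

text \<open>The hinge has slope 0 before \<open>s\<close> and 1 after it, and no segment straddles
  \<open>s\<close> because \<open>s\<close> is in \<open>C\<close>. Writing each term with
  \<open>max a s\<close> and \<open>max b s\<close> keeps the sum telescoping.\<close>

lemma sum_consecutive_hinge:
  fixes C :: "real set"
  assumes "finite C" "s \<in> C"
  shows "(\<Sum>(a, b)\<in>consecutive C. (max (a - s) 0 - max (b - s) 0) * (g a - g b) / (b - a))
    = g (Max C) - g s"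
proof -
  have "(\<Sum>(a, b)\<in>consecutive C. (max (a - s) 0 - max (b - s) 0) * (g a - g b) / (b - a))
      = (\<Sum>(a, b)\<in>consecutive C. g (max b s) - g (max a s))"
  proof (intro sum.cong refl, clarify)
    fix a b assume ab: "(a, b) \<in> consecutive C"
    then have "a < b" "s \<notin> {a<..<b}" using \<open>s \<in> C\<close> by (auto simp: consecutive_def)
    then consider "b \<le> s" | "s \<le> a" by fastforce
    then show "(max (a - s) 0 - max (b - s) 0) * (g a - g b) / (b - a) = g (max b s) - g (max a s)"
    proof cases
      case 1
      then show ?thesis using \<open>a < b\<close> by simp
    next
      case 2
      have "(max (a - s) 0 - max (b - s) 0) * (g a - g b) = (g b - g a) * (b - a)"
        using 2 \<open>a < b\<close> by (simp add: algebra_simps)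
      then show ?thesis using 2 \<open>a < b\<close> by (simp add: max_absorb1)
    qed
  qed
  also have "\<dots> = g (max (Max C) s) - g (max (Min C) s)"
    by (rule sum_consecutive) (use assms in auto)
  also have "\<dots> = g (Max C) - g s"
    using assms by (simp add: max_absorb1 max_absorb2)
  finally show ?thesis .
qed

section \<open>Linear interpolation and the Green function of a segment\<close>

text \<open>Linear interpolation makes the current constant along each edge, so subdividing an edge
  creates no source or sink at the new nodes.\<close>

definition interpolate ::
    "('a, 'b) pre_digraph \<Rightarrow> ('b \<Rightarrow> real) \<Rightarrow> ('a \<Rightarrow> real) \<Rightarrow> ('a, 'b) point \<Rightarrow> real" where
  "interpolate G L F z = (case z of Vertex v \<Rightarrow> F v
     | Inner e t \<Rightarrow> (1 - t / L e) * F (tail G e) + t / L e * F (head G e))"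

text \<open>The Green function of the segment \<open>{0..L e}\<close> with pole \<open>s\<close>, i.e.
  \<open>min s t * (L e - max s t) / L e\<close>, extended by zero to the other edges.\<close>

definition hat :: "('b \<Rightarrow> real) \<Rightarrow> ('a, 'b) point \<Rightarrow> ('a, 'b) point \<Rightarrow> real" where
  "hat L x z = (case (x, z) of
       (Inner e s, Inner e' t) \<Rightarrow> if e = e' then t * (1 - s / L e) - max (t - s) 0 else 0
     | _ \<Rightarrow> 0)"

lemma interpolate_diff:
  "interpolate G L (\<lambda>v. F v - F' v) z = interpolate G L F z - interpolate G L F' z"
  by (cases z) (simp_all add: interpolate_def algebra_simps)

lemma finite_cuts: "finite S \<Longrightarrow> finite (cuts L S e)"
proof -
  assume "finite S"
  then have "finite (Inner e -` S)"
    by (rule finite_vimageI) (simp add: inj_def)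
  then show ?thesis
    unfolding cuts_def by (auto intro: finite_subset[of _ "Inner e -` S"])
qed

context metrized_graph
begin

lemma interpolate_edge_point:
  assumes "e \<in> arcs G"
  shows "interpolate G L F (edge_point G L e t)
    = F (tail G e) + (F (head G e) - F (tail G e)) / L e * t"
  using length_pos[OF assms] by (simp add: interpolate_def edge_point_def field_simps)

text \<open>At \<open>t = 0\<close> and \<open>t = L e\<close> the point is a vertex, where
  \<open>hat\<close> is 0 by definition; the formula gives 0 there too.\<close>

lemma hat_edge_point:
  assumes "0 < s" "s < L e"
  shows "hat L (Inner e s) (edge_point G L e' t)
    = (if e' = e then t * (1 - s / L e) - max (t - s) 0 else 0)"
  using assms by (auto simp: hat_def edge_point_def field_simps)

lemma
  assumes "e \<in> arcs G" "finite S"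
  shows Max_cuts: "Max (cuts L S e) = L e" and Min_cuts: "Min (cuts L S e) = 0"
proof -
  have "finite (cuts L S e)" "0 \<in> cuts L S e" "L e \<in> cuts L S e"
    and "\<And>t. t \<in> cuts L S e \<Longrightarrow> 0 \<le> t \<and> t \<le> L e"
    using length_pos[OF assms(1)] finite_cuts[OF assms(2)] by (auto simp: cuts_def)
  then show "Max (cuts L S e) = L e" "Min (cuts L S e) = 0"
    by (auto intro!: Max_eqI Min_eqI)
qed

lemma arcs_subdivide: "arcs (subdivide G L S) = Sigma (arcs G) (\<lambda>e. consecutive (cuts L S e))"
  by (auto simp: subdivide_def consecutive_def)

lemma fin_digraph_subdivide:
  assumes "finite S"
  shows "fin_digraph (subdivide G L S)"
proof
  show "finite (verts (subdivide G L S))" using assms by (simp add: subdivide_def)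
  have "finite (consecutive (cuts L S e))" for e
    using finite_subset[OF consecutive_subset] finite_cuts[OF assms] by blast
  then show "finite (arcs (subdivide G L S))"
    unfolding arcs_subdivide by (intro finite_SigmaI) auto
next
  fix a assume "a \<in> arcs (subdivide G L S)"
  then show "tail (subdivide G L S) a \<in> verts (subdivide G L S)"
    and "head (subdivide G L S) a \<in> verts (subdivide G L S)"
    by (auto simp: subdivide_def edge_point_def cuts_def)
qed

lemma dirichlet_subdivide:
  assumes "finite S"
  shows "dirichlet (subdivide G L S) segment_length \<phi> \<psi> =
    (\<Sum>e\<in>arcs G. \<Sum>(a, b)\<in>consecutive (cuts L S e).
       (\<phi> (edge_point G L e a) - \<phi> (edge_point G L e b))
     * (\<psi> (edge_point G L e a) - \<psi> (edge_point G L e b)) / (b - a))"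
proof -
  have "finite (consecutive (cuts L S e))" for e
    using finite_subset[OF consecutive_subset] finite_cuts[OF assms] by blast
  then show ?thesis
    unfolding dirichlet_def arcs_subdivide
    by (subst sum.Sigma) (auto intro!: sum.cong simp: subdivide_def segment_length_def)
qed

text \<open>On each edge the telescoping sum for an affine function leaves only the values of
  \<open>\<psi>\<close> at the two ends, which is the term of that edge in \<open>G\<close>.\<close>

lemma dirichlet_interpolate:
  assumes "finite S"
  shows "dirichlet (subdivide G L S) segment_length (interpolate G L F) \<psi>
    = dirichlet G L F (\<lambda>v. \<psi> (Vertex v))"
  unfolding dirichlet_subdivide[OF assms]
  unfolding dirichlet_def
proof (rule sum.cong[OF refl])
  fix e assume e: "e \<in> arcs G"
  have C: "finite (cuts L S e)" "cuts L S e \<noteq> {}"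
    using finite_cuts[OF assms] by (auto simp: cuts_def)
  show "(\<Sum>(a, b)\<in>consecutive (cuts L S e).
       (interpolate G L F (edge_point G L e a) - interpolate G L F (edge_point G L e b))
     * (\<psi> (edge_point G L e a) - \<psi> (edge_point G L e b)) / (b - a))
    = (F (tail G e) - F (head G e)) * (\<psi> (Vertex (tail G e)) - \<psi> (Vertex (head G e))) / L e"
    unfolding interpolate_edge_point[OF e]
      sum_consecutive_affine[OF C, where g = "\<lambda>t. \<psi> (edge_point G L e t)"]
    using length_pos[OF e] by (simp add: Max_cuts Min_cuts e assms edge_point_def field_simps)
qed

text \<open>For an inner point, \<open>hat L x\<close> drives a unit current in at \<open>x\<close>
  and out at the two ends of its edge, split with the interpolation weights of \<open>x\<close>. For
  a vertex both sides vanish.\<close>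

lemma dirichlet_hat:
  assumes "finite S" "x \<in> S" "x \<in> points G L"
  shows "dirichlet (subdivide G L S) segment_length (hat L x) \<psi>
    = \<psi> x - interpolate G L (\<lambda>v. \<psi> (Vertex v)) x"
proof (cases x)
  case (Vertex v)
  then show ?thesis by (simp add: dirichlet_def hat_def interpolate_def)
next
  case x: (Inner e s)
  then have e: "e \<in> arcs G" and s: "0 < s" "s < L e"
    using assms(3) by (auto simp: points_def)
  have C: "finite (cuts L S e)" "cuts L S e \<noteq> {}" "s \<in> cuts L S e"
    using finite_cuts[OF assms(1)] assms(2) x s by (auto simp: cuts_def)
  define g where "g t = \<psi> (edge_point G L e t)" for t
  let ?T = "\<lambda>e. \<Sum>(a, b)\<in>consecutive (cuts L S e).
       (hat L x (edge_point G L e a) - hat L x (edge_point G L e b))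
     * (\<psi> (edge_point G L e a) - \<psi> (edge_point G L e b)) / (b - a)"
  have "(\<Sum>a\<in>arcs G. ?T a) = (\<Sum>a\<in>arcs G. if a = e then ?T e else 0)"
    by (intro sum.cong refl) (auto simp: x hat_edge_point[OF s] intro: sum.neutral)
  also have "\<dots> = ?T e" using e by simp
  \<comment> \<open>Along \<open>e\<close>, \<open>hat\<close> is an affine function minus a hinge
    at \<open>s\<close>; each part has its own telescoping formula.\<close>
  also have "\<dots> = (\<Sum>(a, b)\<in>consecutive (cuts L S e).
        ((0 + (1 - s / L e) * a) - (0 + (1 - s / L e) * b)) * (g a - g b) / (b - a)
      - (max (a - s) 0 - max (b - s) 0) * (g a - g b) / (b - a))"
    unfolding x hat_edge_point[OF s] g_def
    by (intro sum.cong refl) (auto simp: diff_divide_distrib[symmetric] algebra_simps)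
  also have "\<dots> = (1 - s / L e) * (g (L e) - g 0) - (g (L e) - g s)"
    using sum_consecutive_affine[OF C(1,2), where c = 0 and k = "1 - s / L e" and g = g]
      sum_consecutive_hinge[OF C(1,3), of g]
    by (simp only: sum_subtractf split_def Max_cuts[OF e assms(1)] Min_cuts[OF e assms(1)])
  also have "\<dots> = \<psi> x - interpolate G L (\<lambda>v. \<psi> (Vertex v)) x"
    using s by (simp add: x g_def edge_point_def interpolate_def algebra_simps)
  finally show ?thesis unfolding dirichlet_subdivide[OF assms(1)] .
qed


text \<open>Mixing the potentials \<open>h v\<close> with the interpolation weights of
  \<open>x\<close> lets the current enter at the ends of the edge of \<open>x\<close> in these
  proportions and leave at \<open>b\<close>.\<close>

lemma dirichlet_interpolate_family:
  assumes b: "b \<in> verts G" and h: "\<forall>v\<in>verts G. unit_potential G L v b (h v)"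
    and x: "x \<in> points G L"
  shows "dirichlet G L (\<lambda>w. interpolate G L (\<lambda>v. h v w) x) g = interpolate G L g x - g b"
proof -
  have d: "dirichlet G L (h v) g = g v - g b" if "v \<in> verts G" for v
    using h that b by (simp add: unit_potential_iff_dirichlet)
  show ?thesis
  proof (cases x)
    case (Vertex v)
    then show ?thesis using x d by (auto simp: interpolate_def points_def)
  next
    case (Inner e t)
    then have "tail G e \<in> verts G" "head G e \<in> verts G" using x by (auto simp: points_def)
    then have "dirichlet G L (\<lambda>w. interpolate G L (\<lambda>v. h v w) x) g
        = (1 - t / L e) * (g (tail G e) - g b) + t / L e * (g (head G e) - g b)"
      unfolding Inner interpolate_def point.case dirichlet_add_left dirichlet_scale_left
      by (simp only: d)
    then show ?thesis by (simp add: Inner interpolate_def algebra_simps)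
  qed
qed

text \<open>\<open>K\<close> is the Green kernel with sink \<open>b\<close>, interpolated in both
  arguments. A source at \<open>x\<close> is its interpolated source at the vertices, handled by
  \<open>K\<close>, plus the correction \<open>hat L x\<close>; likewise for the sink at
  \<open>y\<close>.\<close>

lemma resistance_eq:
  assumes b: "b \<in> verts G" and h: "\<forall>v\<in>verts G. unit_potential G L v b (h v)"
    and x: "x \<in> points G L" and y: "y \<in> points G L"
  defines "K \<equiv> \<lambda>x z. interpolate G L (\<lambda>w. interpolate G L (\<lambda>v. h v w) x) z"
  shows "resistance G L x y = K x x - K y x - K x y + K y y
    + hat L x x - hat L y x - hat L x y + hat L y y"
proof -
  interpret S: fin_digraph "subdivide G L {x, y}"
    by (rule fin_digraph_subdivide) simp
  have v: "x \<in> verts (subdivide G L {x, y})" "y \<in> verts (subdivide G L {x, y})"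
    by (auto simp: subdivide_def)
  define F where "F w = interpolate G L (\<lambda>v. h v w) x - interpolate G L (\<lambda>v. h v w) y" for w
  define \<phi> where "\<phi> z = interpolate G L F z + (hat L x z - hat L y z)" for z
  have F: "dirichlet G L F g = interpolate G L g x - interpolate G L g y" for g
    unfolding F_def dirichlet_diff_left
    using dirichlet_interpolate_family[OF b h] x y by simp
  \<comment> \<open>The interpolated values of \<open>\<psi>\<close> contributed by \<open>F\<close>
    cancel those contributed by the two hats.\<close>
  have "dirichlet (subdivide G L {x, y}) segment_length \<phi> \<psi> = \<psi> x - \<psi> y" for \<psi>
    unfolding \<phi>_def dirichlet_add_left dirichlet_diff_left
    using x y by (simp add: dirichlet_interpolate dirichlet_hat F)
  then have "unit_potential (subdivide G L {x, y}) segment_length x y \<phi>"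
    by (simp add: S.unit_potential_iff_dirichlet[OF v])
  then have "resistance G L x y = \<phi> x - \<phi> y"
    unfolding resistance_def by (rule S.eff_resistance_eq[OF v])
  also have "\<dots> = K x x - K y x - K x y + K y y + hat L x x - hat L y x - hat L x y + hat L y y"
    unfolding \<phi>_def F_def K_def interpolate_diff by simp
  finally show ?thesis .
qed

section \<open>Resistance between the ends of an edge\<close>

lemma eff_resistance_arc_nonneg:
  assumes "e \<in> arcs G"
  shows "0 \<le> eff_resistance G L (tail G e) (head G e)"
proof -
  have v: "tail G e \<in> verts G" "head G e \<in> verts G" using assms by auto
  obtain f where f: "unit_potential G L (tail G e) (head G e) f"
    using unit_potential_exists[OF v] by blast
  show ?thesis
    unfolding eff_resistance_eq[OF v f] using length_pos v f by (rule unit_potential_drop_nonneg)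
qed

lemma eff_resistance_le_length:
  assumes "p \<in> verts G" "q \<in> verts G" "e \<in> arcs G" "{tail G e, head G e} = {p, q}"
  shows "eff_resistance G L p q \<le> L e"
proof -
  obtain f where f: "unit_potential G L p q f"
    using unit_potential_exists assms by blast
  show ?thesis
    unfolding eff_resistance_eq[OF assms(1,2) f]
    using length_pos assms(1,2) f assms(3,4) by (rule unit_potential_drop_le_length)
qed

lemma eff_resistance_parallel:
  assumes e: "e \<in> arcs G" and c: "Digraph_Component.connected (del_arc e)"
  defines "R \<equiv> eff_resistance (del_arc e) L (tail G e) (head G e)"
  shows "0 \<le> R" and "eff_resistance G L (tail G e) (head G e) = L e * R / (L e + R)"
proof -
  interpret D: metrized_graph "del_arc e" L by (rule metrized_graph_del_arc[OF c])
  have v: "tail G e \<in> verts G" "head G e \<in> verts G" using e by auto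
  then have v': "tail G e \<in> verts (del_arc e)" "head G e \<in> verts (del_arc e)" by auto
  obtain f where f: "unit_potential (del_arc e) L (tail G e) (head G e) f"
    using D.unit_potential_exists[OF v'] by blast
  have R: "R = f (tail G e) - f (head G e)"
    unfolding R_def by (rule D.eff_resistance_eq[OF v' f])
  show "0 \<le> R"
    unfolding R using D.length_pos v' f by (rule D.unit_potential_drop_nonneg)
  have "eff_resistance G L (tail G e) (head G e)
      = L e / (L e + R) * f (tail G e) - L e / (L e + R) * f (head G e)"
    using v unit_potential_of_del_arc[OF e length_pos[OF e] f R \<open>0 \<le> R\<close>] by (rule eff_resistance_eq)
  also have "\<dots> = L e * R / (L e + R)"
    unfolding R by (simp add: algebra_simps diff_divide_distrib)
  finally show "eff_resistance G L (tail G e) (head G e) = L e * R / (L e + R)" .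
qed

section \<open>The resistance function along an edge\<close>

lemma green_family_exists: "\<exists>b h. b \<in> verts G \<and> (\<forall>v\<in>verts G. unit_potential G L v b (h v))"
proof -
  obtain b where b: "b \<in> verts G"
    using connected by (auto simp: connected_def strongly_connected_def)
  have "\<forall>v\<in>verts G. \<exists>f. unit_potential G L v b f" using unit_potential_exists b by blast
  then obtain h where "\<forall>v\<in>verts G. unit_potential G L v b (h v)" by metis
  then show ?thesis using b by blast
qed

text \<open>In \<open>h p - h q\<close> the currents leaving at the common sink \<open>b\<close>
  cancel.\<close>

lemma eff_resistance_green:
  assumes b: "b \<in> verts G" and h: "\<forall>v\<in>verts G. unit_potential G L v b (h v)"
    and "p \<in> verts G" "q \<in> verts G"
  shows "eff_resistance G L p q = h p p - h p q - h q p + h q q"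
proof -
  have "unit_potential G L p q (\<lambda>w. h p w - h q w)"
    using assms
    by (simp add: unit_potential_iff_dirichlet dirichlet_diff_left)
  from eff_resistance_eq[OF assms(3,4) this] show ?thesis by simp
qed

text \<open>With \<open>y\<close> fixed off the interior of \<open>e\<close>, the cross terms are
  affine in \<open>s\<close>. The quadratic part of \<open>K x x\<close> is
  \<open>\<rho> / l\<^sup>2 * s\<^sup>2\<close>, where \<open>\<rho>\<close> is the resistance
  between the ends of \<open>e\<close>, and \<open>hat L x x = s * (1 - s / l)\<close> adds
  \<open>- 1 / l\<close> to the coefficient.\<close>

lemma resistance_off_edge:
  assumes e: "e \<in> arcs G" and y: "y \<in> points G L" "\<And>t. y \<noteq> Inner e t"
  obtains c d where "\<And>s. 0 < s \<Longrightarrow> s < L e \<Longrightarrow> resistance G L (Inner e s) y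
    = (eff_resistance G L (tail G e) (head G e) - L e) / (L e)\<^sup>2 * s\<^sup>2 + c * s + d"
proof -
  obtain b h where b: "b \<in> verts G" and h: "\<forall>v\<in>verts G. unit_potential G L v b (h v)"
    using green_family_exists by blast
  define p q l where "p = tail G e" and "q = head G e" and "l = L e"
  have l: "l \<noteq> 0" using length_pos[OF e] by (simp add: l_def)
  have \<rho>: "eff_resistance G L p q = h p p - h p q - h q p + h q q"
    using b h e by (intro eff_resistance_green) (auto simp: p_def q_def)
  \<comment> \<open>\<open>Y\<close> and \<open>Z\<close> hold the values at the vertices of the
    cross terms with \<open>y\<close> in the first and in the second argument of the kernel.\<close>
  define Y where "Y w = interpolate G L (\<lambda>v. h v w) y" for w
  define Z where "Z v = interpolate G L (h v) y" for v
  define k where "k = interpolate G L Y y + hat L y y"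
  have Zlin: "interpolate G L (\<lambda>w. \<alpha> * h p w + \<beta> * h q w) y = \<alpha> * Z p + \<beta> * Z q" for \<alpha> \<beta>
    unfolding Z_def by (cases y) (simp_all add: interpolate_def algebra_simps)
  have hat0: "hat L (Inner e s) y = 0" "hat L y (Inner e s) = 0" for s
    using y(2) by (cases y; auto simp: hat_def)+
  define d where "d = h p p - Y p - Z p + k"
  define c where "c = (h p q + h q p - 2 * h p p) / l + 1 - (Y q - Y p) / l - (Z q - Z p) / l"
  show ?thesis
  proof (rule that[of c d])
    fix s assume s: "0 < s" "s < L e"
    have x: "Inner e s \<in> points G L" using s e by (auto simp: points_def)
    define u where "u = s / l"
    have s': "s = l * u" using l by (simp add: u_def)
    have "resistance G L (Inner e s) y =
        ((1 - u) * ((1 - u) * h p p + u * h q p) + u * ((1 - u) * h p q + u * h q q))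
      - ((1 - u) * Y p + u * Y q) - ((1 - u) * Z p + u * Z q) + k + s * (1 - u)"
      unfolding resistance_eq[OF b h x y(1)] hat0 k_def
        interpolate_def[of G L _ "Inner e s"] point.case
      unfolding p_def[symmetric] q_def[symmetric] l_def[symmetric] u_def[symmetric] Zlin Y_def[symmetric]
      by (simp add: hat_def u_def l_def)
    also have "\<dots> = (eff_resistance G L p q - l) / l\<^sup>2 * s\<^sup>2 + c * s + d"
      unfolding s' c_def d_def \<rho> using l by (simp add: field_simps power2_eq_square)
    finally show "resistance G L (Inner e s) y
        = (eff_resistance G L (tail G e) (head G e) - L e) / (L e)\<^sup>2 * s\<^sup>2 + c * s + d"
      unfolding p_def q_def l_def .
  qed
qed

text \<open>The interpolation weights of the two points differ by
  \<open>\<plusminus> (s - t) / L e\<close> at the two ends, so the four kernel terms give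
  \<open>\<rho> * (s - t)\<^sup>2 / (L e)\<^sup>2\<close>, with \<open>\<rho>\<close> the resistance
  between the ends. The four hat terms give
  \<open>\<bar>s - t\<bar> - (s - t)\<^sup>2 / L e\<close>.\<close>

lemma resistance_on_edge:
  assumes e: "e \<in> arcs G" and s: "0 < s" "s < L e" and t: "0 < t" "t < L e"
  shows "resistance G L (Inner e s) (Inner e t) = \<bar>s - t\<bar>
    + (eff_resistance G L (tail G e) (head G e) - L e) / (L e)\<^sup>2 * (s - t)\<^sup>2"
proof -
  obtain b h where b: "b \<in> verts G" and h: "\<forall>v\<in>verts G. unit_potential G L v b (h v)"
    using green_family_exists by blast
  define p q l where "p = tail G e" and "q = head G e" and "l = L e"
  have l: "l \<noteq> 0" using length_pos[OF e] by (simp add: l_def)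
  have \<rho>: "eff_resistance G L p q = h p p - h p q - h q p + h q q"
    using b h e by (intro eff_resistance_green) (auto simp: p_def q_def)
  have xy: "Inner e s \<in> points G L" "Inner e t \<in> points G L" using s t e by (auto simp: points_def)
  define u v where "u = s / l" and "v = t / l"
  have s': "s = l * u" and t': "t = l * v" using l by (simp_all add: u_def v_def)
  have K: "interpolate G L (\<lambda>w. interpolate G L (\<lambda>v. h v w) (Inner e s)) (Inner e t)
      = (1 - t / l) * ((1 - s / l) * h p p + s / l * h q p)
      + t / l * ((1 - s / l) * h p q + s / l * h q q)" for s t
    by (simp add: interpolate_def p_def q_def l_def)
  have "resistance G L (Inner e s) (Inner e t) =
      (u - v)\<^sup>2 * eff_resistance G L p q
      + s * (1 - u) + t * (1 - v) - s * (1 - v) - t * (1 - u) + \<bar>s - t\<bar>"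
    unfolding resistance_eq[OF b h xy] K \<rho> u_def[symmetric] v_def[symmetric]
    by (simp add: hat_def u_def[symmetric, unfolded l_def] v_def[symmetric, unfolded l_def]
        algebra_simps power2_eq_square abs_if max_def)
  also have "\<dots> = \<bar>s - t\<bar> + (eff_resistance G L p q - l) / l\<^sup>2 * (s - t)\<^sup>2"
    unfolding s' t' using l by (simp add: field_simps power2_eq_square)
  finally show ?thesis unfolding p_def q_def l_def .
qed

end

section \<open>Integrals of squared derivatives\<close>

text \<open>The derivative is known only inside the interval; the two end points do not affect the
  integral.\<close>

lemma has_integral_square_deriv_affine:
  fixes f :: "real \<Rightarrow> real"
  assumes "u \<le> v" and "\<And>s. u < s \<Longrightarrow> s < v \<Longrightarrow> (f has_real_derivative a + b * s) (at s)"
  shows "((\<lambda>s. (deriv f s)\<^sup>2) has_integral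
    (a\<^sup>2 * v + a * b * v\<^sup>2 + b\<^sup>2 * v ^ 3 / 3) - (a\<^sup>2 * u + a * b * u\<^sup>2 + b\<^sup>2 * u ^ 3 / 3)) {u..v}"
proof -
  have "((\<lambda>s. (a + b * s)\<^sup>2) has_integral
    (a\<^sup>2 * v + a * b * v\<^sup>2 + b\<^sup>2 * v ^ 3 / 3) - (a\<^sup>2 * u + a * b * u\<^sup>2 + b\<^sup>2 * u ^ 3 / 3)) {u..v}"
    using assms(1)
  proof (rule fundamental_theorem_of_calculus)
    fix s :: real
    show "((\<lambda>v. a\<^sup>2 * v + a * b * v\<^sup>2 + b\<^sup>2 * v ^ 3 / 3) has_vector_derivative (a + b * s)\<^sup>2)
        (at s within {u..v})"
      unfolding has_real_derivative_iff_has_vector_derivative[symmetric]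
      by (auto intro!: derivative_eq_intros simp: power2_eq_square algebra_simps)
  qed
  then show ?thesis
  proof (rule has_integral_spike_finite[rotated 2])
    show "finite {u, v}" by simp
    fix s assume "s \<in> {u..v} - {u, v}"
    then show "(deriv f s)\<^sup>2 = (a + b * s)\<^sup>2"
      using assms(2)[of s] by (auto dest: DERIV_imp_deriv)
  qed
qed

text \<open>The derivative is affine with mean \<open>a * l + c\<close>. The integral of its square
  is \<open>l\<close> times the squared mean plus the integral of the squared deviation, and the
  latter is \<open>a\<^sup>2 * l ^ 3 / 3\<close>.\<close>

lemma integral_square_deriv_quadratic_ge:
  fixes f :: "real \<Rightarrow> real"
  assumes l: "0 < l" and f: "\<And>s. 0 < s \<Longrightarrow> s < l \<Longrightarrow> f s = a * s\<^sup>2 + c * s + d"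
  shows "a\<^sup>2 * l ^ 3 / 3 \<le> integral {0..l} (\<lambda>s. (deriv f s)\<^sup>2)"
proof -
  have "(f has_real_derivative c + 2 * a * s) (at s)" if "0 < s" "s < l" for s
  proof (rule has_field_derivative_transform_within_open[where S = "{0<..<l}"])
    show "((\<lambda>s. a * s\<^sup>2 + c * s + d) has_real_derivative c + 2 * a * s) (at s)"
      by (auto intro!: derivative_eq_intros)
  qed (use that f in auto)
  then have "((\<lambda>s. (deriv f s)\<^sup>2) has_integral
     (c\<^sup>2 * l + c * (2 * a) * l\<^sup>2 + (2 * a)\<^sup>2 * l ^ 3 / 3)
     - (c\<^sup>2 * 0 + c * (2 * a) * 0\<^sup>2 + (2 * a)\<^sup>2 * 0 ^ 3 / 3)) {0..l}"
    using l by (intro has_integral_square_deriv_affine) auto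
  then have "integral {0..l} (\<lambda>s. (deriv f s)\<^sup>2) = a\<^sup>2 * l ^ 3 / 3 + l * (a * l + c)\<^sup>2"
    by (simp add: integral_unique power2_eq_square power3_eq_cube algebra_simps)
  then show ?thesis using l by simp
qed

text \<open>Integrating separately on both sides of the kink \<open>t\<close> gives the bound plus
  two further terms, which the sign conditions on \<open>a\<close> and \<open>1 + a * l\<close> make
  nonnegative.\<close>

lemma integral_square_deriv_abs_quadratic_ge:
  fixes f :: "real \<Rightarrow> real"
  assumes t: "0 < t" "t < l" and a: "a \<le> 0" "- 1 \<le> a * l"
    and f: "\<And>s. 0 < s \<Longrightarrow> s < l \<Longrightarrow> f s = \<bar>s - t\<bar> + a * (s - t)\<^sup>2"
  shows "a\<^sup>2 * l ^ 3 / 3 \<le> integral {0..l} (\<lambda>s. (deriv f s)\<^sup>2)"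
proof -
  have "(f has_real_derivative (- 1 - 2 * a * t) + 2 * a * s) (at s)" if "0 < s" "s < t" for s
  proof (rule has_field_derivative_transform_within_open[where S = "{0<..<t}"])
    show "((\<lambda>s. (t - s) + a * (s - t)\<^sup>2) has_real_derivative (- 1 - 2 * a * t) + 2 * a * s) (at s)"
      by (auto intro!: derivative_eq_intros simp: algebra_simps)
  qed (use that f t in auto)
  then have 1: "((\<lambda>s. (deriv f s)\<^sup>2) has_integral
     ((- 1 - 2 * a * t)\<^sup>2 * t + (- 1 - 2 * a * t) * (2 * a) * t\<^sup>2 + (2 * a)\<^sup>2 * t ^ 3 / 3)
     - ((- 1 - 2 * a * t)\<^sup>2 * 0 + (- 1 - 2 * a * t) * (2 * a) * 0\<^sup>2 + (2 * a)\<^sup>2 * 0 ^ 3 / 3)) {0..t}"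
    using t by (intro has_integral_square_deriv_affine) auto
  have "(f has_real_derivative (1 - 2 * a * t) + 2 * a * s) (at s)" if "t < s" "s < l" for s
  proof (rule has_field_derivative_transform_within_open[where S = "{t<..<l}"])
    show "((\<lambda>s. (s - t) + a * (s - t)\<^sup>2) has_real_derivative (1 - 2 * a * t) + 2 * a * s) (at s)"
      by (auto intro!: derivative_eq_intros simp: algebra_simps)
  qed (use that f t in auto)
  then have 2: "((\<lambda>s. (deriv f s)\<^sup>2) has_integral
     ((1 - 2 * a * t)\<^sup>2 * l + (1 - 2 * a * t) * (2 * a) * l\<^sup>2 + (2 * a)\<^sup>2 * l ^ 3 / 3)
     - ((1 - 2 * a * t)\<^sup>2 * t + (1 - 2 * a * t) * (2 * a) * t\<^sup>2 + (2 * a)\<^sup>2 * t ^ 3 / 3)) {t..l}"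
    using t by (intro has_integral_square_deriv_affine) auto
  have "integral {0..l} (\<lambda>s. (deriv f s)\<^sup>2)
      = a\<^sup>2 * l ^ 3 / 3 + (l * (1 + a * l)\<^sup>2 + 4 * (- a) * (t * (l - t)) * (1 + a * l))"
    using integral_unique[OF has_integral_combine[OF _ _ 1 2]] t
    by (simp add: power2_eq_square power3_eq_cube algebra_simps)
  moreover have "0 \<le> 4 * (- a) * (t * (l - t)) * (1 + a * l)"
    using t a by (intro mult_nonneg_nonneg) auto
  moreover have "0 \<le> l * (1 + a * l)\<^sup>2" using t by simp
  ultimately show ?thesis by linarith
qed

lemma (in metrized_graph) edge_integral_ge:
  assumes e: "e \<in> arcs G" and y: "y \<in> points G L"
  shows "((eff_resistance G L (tail G e) (head G e) - L e) / (L e)\<^sup>2)\<^sup>2 * L e ^ 3 / 3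
    \<le> integral {0..L e} (\<lambda>t. (deriv (\<lambda>s. resistance G L (edge_point G L e s) y) t)\<^sup>2)"
proof (cases "\<exists>t. y = Inner e t")
  case False
  then obtain c d where "\<And>s. 0 < s \<Longrightarrow> s < L e \<Longrightarrow> resistance G L (Inner e s) y
    = (eff_resistance G L (tail G e) (head G e) - L e) / (L e)\<^sup>2 * s\<^sup>2 + c * s + d"
    using resistance_off_edge[OF e y] by blast
  then show ?thesis
    using length_pos[OF e]
    by (intro integral_square_deriv_quadratic_ge[where c = c and d = d]) (auto simp: edge_point_def)
next
  case True
  then obtain t where t: "y = Inner e t" "0 < t" "t < L e" using y by (auto simp: points_def)
  define \<rho> where "\<rho> = eff_resistance G L (tail G e) (head G e)"
  have l: "0 < L e" by (rule length_pos[OF e])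
  have \<rho>: "0 \<le> \<rho>" "\<rho> \<le> L e"
    using eff_resistance_arc_nonneg[OF e] eff_resistance_le_length[of "tail G e" "head G e" e] e
    by (auto simp: \<rho>_def)
  \<comment> \<open>The conditions of the kink case amount to \<open>\<rho> \<le> L e\<close> and
    \<open>0 \<le> \<rho>\<close>.\<close>
  have "(\<rho> - L e) / (L e)\<^sup>2 \<le> 0" "- 1 \<le> (\<rho> - L e) / (L e)\<^sup>2 * L e"
    using \<rho> l by (simp_all add: divide_nonpos_pos power2_eq_square field_simps)
  then show ?thesis
    unfolding \<rho>_def t(1) using t resistance_on_edge[OF e]
    by (intro integral_square_deriv_abs_quadratic_ge[where t = t]) (auto simp: edge_point_def)
qed


section \<open>The lower bounds\<close>

text \<open>The left side is the tangent of the convex function \<open>1 / x\<^sup>2\<close> at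
  \<open>c\<close>; the gap factors explicitly.\<close>

lemma inverse_square_tangent_le:
  fixes x c :: real
  assumes "0 < x" "0 < c"
  shows "3 / c\<^sup>2 - 2 * x / c ^ 3 \<le> 1 / x\<^sup>2"
proof -
  have "1 / x\<^sup>2 - (3 / c\<^sup>2 - 2 * x / c ^ 3) = (c - x)\<^sup>2 * (c + 2 * x) / (x\<^sup>2 * c ^ 3)"
    using assms by (simp add: field_simps power2_eq_square power3_eq_cube)
  moreover have "0 \<le> (c - x)\<^sup>2 * (c + 2 * x) / (x\<^sup>2 * c ^ 3)"
    using assms by simp
  ultimately show ?thesis by linarith
qed

text \<open>Jensen's inequality for \<open>1 / x\<^sup>2\<close> with weights \<open>l\<close> at the points \<open>(l i + r i) / l i\<close>.\<close>

lemma sum_cube_over_square_ge: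
  fixes l r :: "'i \<Rightarrow> real"
  assumes "finite A" "(\<Sum>i\<in>A. l i) = 1"
    and "\<And>i. i \<in> A \<Longrightarrow> 0 < l i" "\<And>i. i \<in> A \<Longrightarrow> 0 \<le> r i"
  shows "1 / (1 + (\<Sum>i\<in>A. r i))\<^sup>2 \<le> (\<Sum>i\<in>A. l i ^ 3 / (l i + r i)\<^sup>2)"
proof -
  \<comment> \<open>\<open>c\<close> is the weighted mean of the points
    \<open>(l i + r i) / l i\<close>; the tangent is taken there.\<close>
  define c where "c = 1 + (\<Sum>i\<in>A. r i)"
  have c: "0 < c" using sum_nonneg[of A r] assms by (simp add: c_def)
  have "3 / c\<^sup>2 * l i - 2 / c ^ 3 * (l i + r i) \<le> l i ^ 3 / (l i + r i)\<^sup>2" if i: "i \<in> A" for i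
  proof -
    have p: "0 < l i" "0 \<le> r i" using assms i by auto
    have "l i * (3 / c\<^sup>2 - 2 * ((l i + r i) / l i) / c ^ 3) \<le> l i * (1 / ((l i + r i) / l i)\<^sup>2)"
      using p c by (intro mult_left_mono inverse_square_tangent_le) auto
    also have "l i * (1 / ((l i + r i) / l i)\<^sup>2) = l i ^ 3 / (l i + r i)\<^sup>2"
      by (simp add: power_divide power2_eq_square power3_eq_cube)
    also have "l i * (3 / c\<^sup>2 - 2 * ((l i + r i) / l i) / c ^ 3)
        = 3 / c\<^sup>2 * l i - 2 / c ^ 3 * (l i + r i)"
      using p by (simp add: right_diff_distrib)
    finally show ?thesis .
  qed
  then have "(\<Sum>i\<in>A. 3 / c\<^sup>2 * l i - 2 / c ^ 3 * (l i + r i)) \<le> (\<Sum>i\<in>A. l i ^ 3 / (l i + r i)\<^sup>2)"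
    by (rule sum_mono)
  moreover have "(\<Sum>i\<in>A. 3 / c\<^sup>2 * l i - 2 / c ^ 3 * (l i + r i)) = 3 / c\<^sup>2 - 2 / c ^ 3 * c"
    unfolding sum_subtractf sum_distrib_left[symmetric] sum.distrib assms(2) c_def by simp
  moreover have "3 / c\<^sup>2 - 2 / c ^ 3 * c = 1 / c\<^sup>2"
    using c by (simp add: power2_eq_square power3_eq_cube)
  ultimately show ?thesis by (simp add: c_def)
qed

text \<open>Let \<open>m\<close> minimize \<open>g\<close>. For \<open>i \<noteq> m\<close>,
  \<open>f i \<le> g m \<le> g i\<close>. Only \<open>f m\<close> may exceed \<open>g m\<close>, so
  \<open>m\<close> is paired crosswise with another index \<open>j\<close>. Applied with resistances
  \<open>f\<close> and lengths \<open>g\<close> of parallel edges.\<close>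

lemma sum_le_sum_if_le_others:
  fixes f g :: "'i \<Rightarrow> real"
  assumes A: "finite A" "2 \<le> card A" and le: "\<And>i j. i \<in> A \<Longrightarrow> j \<in> A \<Longrightarrow> i \<noteq> j \<Longrightarrow> f i \<le> g j"
  shows "sum f A \<le> sum g A"
proof -
  have "A \<noteq> {}" using A by auto
  then obtain m where m: "m \<in> A" "\<And>i. i \<in> A \<Longrightarrow> g m \<le> g i"
    using arg_min_if_finite[OF A(1), of g] by (metis not_le)
  have "A - {m} \<noteq> {}"
  proof
    assume "A - {m} = {}"
    then have "A = {m}" using m by blast
    then show False using A by simp
  qed
  then obtain j where j: "j \<in> A" "j \<noteq> m" by blast
  have split: "sum h A = h m + (h j + sum h (A - {m} - {j}))" for h :: "'i \<Rightarrow> real"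
    using A m j by (simp add: sum.remove[of A m] sum.remove[of "A - {m}" j])
  have "sum f (A - {m} - {j}) \<le> sum g (A - {m} - {j})"
    using m le by (intro sum_mono) (metis DiffD1 DiffD2 insertI1 order.trans)
  moreover have "f m \<le> g j" "f j \<le> g m" using le m j by auto
  ultimately show ?thesis unfolding split by linarith
qed

section \<open>Bounds for the tau constant\<close>

context metrized_graph
begin

lemma tau_nonneg: "y \<in> points G L \<Longrightarrow> 0 \<le> tau G L y"
proof -
  assume y: "y \<in> points G L"
  have "0 \<le> integral {0..L e} (\<lambda>t. (deriv (\<lambda>s. resistance G L (edge_point G L e s) y) t)\<^sup>2)"
    if e: "e \<in> arcs G" for e
    using length_pos[OF e] by (intro order.trans[OF _ edge_integral_ge[OF e y]]) simp
  then show ?thesis unfolding tau_def by (simp add: sum_nonneg)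
qed

lemma edge_resistance_connected:
  "Digraph_Component.connected (del_arc e) \<Longrightarrow> edge_resistance G L e
    = ereal (eff_resistance (del_arc e) L (tail G e) (head G e))"
  by (simp add: edge_resistance_def)

lemma edge_integral_ge_connected:
  assumes e: "e \<in> arcs G" and c: "Digraph_Component.connected (del_arc e)" and y: "y \<in> points G L"
  shows "1 / 3 * (L e ^ 3 / (L e + eff_resistance (del_arc e) L (tail G e) (head G e))\<^sup>2)
    \<le> integral {0..L e} (\<lambda>t. (deriv (\<lambda>s. resistance G L (edge_point G L e s) y) t)\<^sup>2)"
proof -
  define R where "R = eff_resistance (del_arc e) L (tail G e) (head G e)"
  have l: "0 < L e" by (rule length_pos[OF e])
  have R: "0 \<le> R" "eff_resistance G L (tail G e) (head G e) = L e * R / (L e + R)"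
    unfolding R_def by (rule eff_resistance_parallel[OF e c])+
  have "(L e * R / (L e + R) - L e) / (L e)\<^sup>2 = - (1 / (L e + R))"
  proof -
    have "L e * R / (L e + R) - L e = - ((L e)\<^sup>2 / (L e + R))"
      using l R(1) by (simp add: field_simps power2_eq_square)
    then show ?thesis using l by simp
  qed
  then show ?thesis
    using edge_integral_ge[OF e y] unfolding R(2) R_def[symmetric] by (simp add: power_divide)
qed

lemma tau_ge:
  assumes len: "total_length G L = 1" and y: "y \<in> points G L"
    and c: "\<And>e. e \<in> arcs G \<Longrightarrow> Digraph_Component.connected (del_arc e)"
  shows "1 / 12 * (1 / (1 + (\<Sum>e\<in>arcs G. eff_resistance (del_arc e) L (tail G e) (head G e)))\<^sup>2)
    \<le> tau G L y"
proof -
  let ?R = "\<lambda>e. eff_resistance (del_arc e) L (tail G e) (head G e)"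
  have "1 / (1 + sum ?R (arcs G))\<^sup>2 \<le> (\<Sum>e\<in>arcs G. L e ^ 3 / (L e + ?R e)\<^sup>2)"
    using len length_pos eff_resistance_parallel(1) c
    by (intro sum_cube_over_square_ge) (auto simp: total_length_def)
  moreover have "1 / 3 * (\<Sum>e\<in>arcs G. L e ^ 3 / (L e + ?R e)\<^sup>2) \<le> 4 * tau G L y"
    unfolding tau_def sum_distrib_left using edge_integral_ge_connected[OF _ c y]
    by (simp add: sum_mono)
  ultimately show ?thesis by linarith
qed

lemma tau_ge_ereal:
  assumes len: "total_length G L = 1" and y: "y \<in> points G L"
  shows "ereal (1 / 12) * (1 / (1 + (\<Sum>e\<in>arcs G. edge_resistance G L e))\<^sup>2) \<le> ereal (tau G L y)"
proof (cases "\<forall>e\<in>arcs G. Digraph_Component.connected (del_arc e)")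
  case True
  let ?R = "\<lambda>e. eff_resistance (del_arc e) L (tail G e) (head G e)"
  have "(\<Sum>e\<in>arcs G. edge_resistance G L e) = (\<Sum>e\<in>arcs G. ereal (?R e))"
    using True by (intro sum.cong refl edge_resistance_connected) auto
  then have s: "1 + (\<Sum>e\<in>arcs G. edge_resistance G L e) = ereal (1 + sum ?R (arcs G))"
    by (simp add: one_ereal_def)
  have "0 \<le> sum ?R (arcs G)"
    using True eff_resistance_parallel(1) by (intro sum_nonneg) auto
  then have "ereal (1 / 12) * (1 / (1 + (\<Sum>e\<in>arcs G. edge_resistance G L e))\<^sup>2)
      = ereal (1 / 12 * (1 / (1 + sum ?R (arcs G))\<^sup>2))"
    unfolding s by (simp add: one_ereal_def)
  then show ?thesis using tau_ge[OF len y] True by simp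
next
  case False
  then obtain e where "e \<in> arcs G" "edge_resistance G L e = \<infinity>"
    by (auto simp: edge_resistance_def)
  then have "(\<Sum>e\<in>arcs G. edge_resistance G L e) = \<infinity>"
    by (auto simp: sum_Pinfty)
  \<comment> \<open>With a bridge the bound is \<open>1 / \<infinity>\<close>, which is 0 in
    \<open>ereal\<close>.\<close>
  then show ?thesis using tau_nonneg[OF y] by (simp add: power2_eq_square)
qed

lemma tau_ge_multi_edges:
  assumes len: "total_length G L = 1" and y: "y \<in> points G L"
    and multi: "\<And>p q. p \<noteq> q \<Longrightarrow> edges_between G p q \<noteq> {} \<Longrightarrow> 2 \<le> card (edges_between G p q)"
  shows "1 / 48 \<le> tau G L y"
proof -
  let ?R = "\<lambda>e. eff_resistance (del_arc e) L (tail G e) (head G e)"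
  have par: "\<exists>a\<in>arcs G - {e}. {tail G a, head G a} = {tail G e, head G e}"
    if "e \<in> arcs G" "tail G e \<noteq> head G e" for e
  proof -
    let ?B = "edges_between G (tail G e) (head G e)"
    have "e \<in> ?B" using that by (simp add: edges_between_def)
    then have "2 \<le> card ?B" using multi[OF that(2)] by blast
    then have "\<not> ?B \<subseteq> {e}" using card_mono[of "{e}" ?B] by auto
    then show ?thesis by (auto simp: edges_between_def)
  qed
  have c: "Digraph_Component.connected (del_arc e)" if "e \<in> arcs G" for e
    using par[OF that] by (intro connected_del_arc connected) blast
  \<comment> \<open>The parallel edge \<open>j\<close> survives the deletion of \<open>i\<close> and
    bounds the resistance between its ends.\<close>
  have R_le: "?R i \<le> L j"
    if "i \<in> arcs G" "j \<in> arcs G" "i \<noteq> j" "{tail G j, head G j} = {tail G i, head G i}" for i j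
  proof -
    interpret D: metrized_graph "del_arc i" L by (rule metrized_graph_del_arc[OF c[OF that(1)]])
    show ?thesis
      by (rule D.eff_resistance_le_length) (use that in auto)
  qed
  \<comment> \<open>Loops fall outside \<open>multi\<close>, but their two ends coincide.\<close>
  have R_loop: "?R e = 0" if "e \<in> arcs G" "tail G e = head G e" for e
  proof -
    interpret D: fin_digraph "del_arc e" by (rule fin_digraph_del_arc)
    have v: "tail G e \<in> verts (del_arc e)" using that by simp
    obtain f where "unit_potential (del_arc e) L (tail G e) (tail G e) f"
      using D.unit_potential_refl[OF v] by blast
    from D.eff_resistance_eq[OF v v this] show ?thesis using that by simp
  qed
  \<comment> \<open>The unordered pair of ends sorts the edges into classes of parallel ones. In
    each class the sum of the resistances is at most the sum of the lengths.\<close>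
  define ends where "ends e = {tail G e, head G e}" for e
  have "sum ?R {e \<in> arcs G. ends e = B} \<le> sum L {e \<in> arcs G. ends e = B}"
    if B: "B \<in> ends ` arcs G" for B
  proof -
    obtain a where a: "a \<in> arcs G" "B = ends a" using B by blast
    show ?thesis
    proof (cases "tail G a = head G a")
      case True
      have "?R e \<le> L e" if e: "e \<in> {e \<in> arcs G. ends e = B}" for e
      proof -
        have "tail G e = head G e" using e a True by (auto simp: ends_def)
        then show ?thesis using R_loop[of e] length_pos[of e] e by simp
      qed
      then show ?thesis by (rule sum_mono)
    next
      case False
      have eq: "{e \<in> arcs G. ends e = B} = edges_between G (tail G a) (head G a)"
        by (auto simp: edges_between_def ends_def a)
      have "a \<in> edges_between G (tail G a) (head G a)" using a by (simp add: edges_between_def)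
      then have "2 \<le> card {e \<in> arcs G. ends e = B}"
        unfolding eq using multi[OF False] by blast
      then show ?thesis
        using R_le by (intro sum_le_sum_if_le_others) (auto simp: ends_def)
    qed
  qed
  then have "(\<Sum>B\<in>ends ` arcs G. sum ?R {e \<in> arcs G. ends e = B})
      \<le> (\<Sum>B\<in>ends ` arcs G. sum L {e \<in> arcs G. ends e = B})"
    by (rule sum_mono)
  then have "sum ?R (arcs G) \<le> 1"
    using len by (simp add: sum.group total_length_def)
  moreover have "0 \<le> sum ?R (arcs G)"
    using c eff_resistance_parallel(1) by (intro sum_nonneg) auto
  ultimately have "(1 + sum ?R (arcs G))\<^sup>2 \<le> 2\<^sup>2" "0 < (1 + sum ?R (arcs G))\<^sup>2"
    by (intro power_mono zero_less_power; simp)+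
  \<comment> \<open>The resistances sum to at most 1, so the denominator is at most
    \<open>2\<^sup>2\<close>.\<close>
  then have "1 / 12 * (1 / 4) \<le> 1 / 12 * (1 / (1 + sum ?R (arcs G))\<^sup>2)"
    by (intro mult_left_mono frac_le) auto
  then show ?thesis using tau_ge[OF len y c] by linarith
qed

end

theorem theorem2p25:
  fixes G :: "('a, 'b) pre_digraph" and L :: "'b \<Rightarrow> real" and y :: "('a, 'b) point"
  assumes "metrized_graph G L"
    and "total_length G L = 1"
    and "y \<in> points G L"
  shows "ereal (tau G L y) \<ge> ereal (1 / 12) * (1 / (1 + (\<Sum>e\<in>arcs G. edge_resistance G L e))\<^sup>2)
    \<and> ((\<forall>p q. p \<noteq> q \<and> edges_between G p q \<noteq> {} \<longrightarrow> card (edges_between G p q) \<ge> 2)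
         \<longrightarrow> tau G L y \<ge> 1 / 48)"
  using metrized_graph.tau_ge_ereal[OF assms] metrized_graph.tau_ge_multi_edges[OF assms] by blast

end
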